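(* Let $\alpha>3$, $\beta>0$, $t_0>0$, and let $\Phi:\mathcal H\to\mathbb R$ be a twice continuously differentiable convex function such that the interior (in the norm topology) of $\operatorname{argmin}\Phi$ is nonempty. Let $x:[t_0,+\infty[\to\mathcal H$ be a classical global solution of $$\ddot x(t)+\frac{\alpha}{t}\dot x(t)+\beta\nabla^2\Phi(x(t))\dot x(t)+\nabla\Phi(x(t))=0 .$$ Then $x(t)$ converges strongly, as $t\to+\infty$, to some $x^*\in\operatorname{argmin}\Phi$. Moreover, $$\int_{t_0}^\infty t\,\|\nabla\Phi(x(t))\|\,dt<+\infty .$$
   Context: $\mathcal H$ is a real Hilbert space with norm $\|\cdot\|$. A classical global solution is a twice continuously differentiable function satisfying the equation for all $t\ge t_0$. *)

theory Defs
  imports "HOL-Analysis.Analysis"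
begin

text \<open>Twice continuous Frechet differentiability on the whole space; the first and second
  derivatives are bounded linear maps and continuity of the second one is with respect to the
  operator norm.\<close>

definition twice_cont_diff ::
    "('a::real_normed_vector \<Rightarrow> 'b::real_normed_vector) \<Rightarrow> bool" where
  "twice_cont_diff f \<longleftrightarrow>
     (\<exists>(D1 :: 'a \<Rightarrow> 'a \<Rightarrow>\<^sub>L 'b) (D2 :: 'a \<Rightarrow> 'a \<Rightarrow>\<^sub>L 'a \<Rightarrow>\<^sub>L 'b).
        (\<forall>x. (f has_derivative blinfun_apply (D1 x)) (at x)) \<and>
        (\<forall>x. (D1 has_derivative blinfun_apply (D2 x)) (at x)) \<and>
        continuous_on UNIV D2)"

text \<open>The gradient is the Riesz representative of the derivative. The Hessian is the linear
  operator obtained by differentiating the gradient map. For a twice continuously differentiable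
  function on a Hilbert space both are well defined at every point.\<close>

definition gradient :: "('a::real_inner \<Rightarrow> real) \<Rightarrow> 'a \<Rightarrow> 'a" where
  "gradient f x = (THE g. GDERIV f x :> g)"

definition hessian :: "('a::real_inner \<Rightarrow> real) \<Rightarrow> 'a \<Rightarrow> 'a \<Rightarrow> 'a" where
  "hessian f x = frechet_derivative (gradient f) (at x)"

definition argmin_set :: "('a \<Rightarrow> real) \<Rightarrow> 'a set" where
  "argmin_set f = {z. \<forall>y. f z \<le> f y}"

text \<open>Derivatives of the trajectory are taken within \<open>{t0..}\<close>, hence one-sided at \<open>t0\<close>; values
  of \<open>x\<close> at times before \<open>t0\<close> are irrelevant.\<close>

definition classical_global_solution ::
    "real \<Rightarrow> real \<Rightarrow> real \<Rightarrow> ('a::real_inner \<Rightarrow> real) \<Rightarrow> (real \<Rightarrow> 'a) \<Rightarrow> bool" where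
  "classical_global_solution \<alpha> \<beta> t0 \<Phi> x \<longleftrightarrow>
     (\<exists>x' x''.
        (\<forall>t\<ge>t0. (x has_vector_derivative x' t) (at t within {t0..})) \<and>
        (\<forall>t\<ge>t0. (x' has_vector_derivative x'' t) (at t within {t0..})) \<and>
        continuous_on {t0..} x'' \<and>
        (\<forall>t\<ge>t0. x'' t + (\<alpha> / t) *\<^sub>R x' t + \<beta> *\<^sub>R hessian \<Phi> (x t) (x' t)
                   + gradient \<Phi> (x t) = 0))"

end

theory Submission
  imports Defs
begin

text \<open>Let \<open>z\<close> be the centre of a ball of radius \<open>r\<close> of minimisers and \<open>g t\<close> the gradient at \<open>x t\<close>.
  Along the flow, \<open>u = (\<alpha> - 1) (x - z) + t (x' + \<beta> g)\<close> satisfies \<open>u' = - (t - \<beta>) g\<close>. Hence the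
  energy \<open>E = t (t - \<beta>) (\<Phi> x - \<Phi> z) + |u|\<^sup>2 / 2\<close> has a derivative that convexity and the
  bound \<open>\<langle>g, x - z\<rangle> \<ge> r |g|\<close> turn into \<open>E' \<le> - c (t - \<beta>) |g|\<close> for large \<open>t\<close>. So \<open>t |g|\<close> is
  integrable and \<open>u\<close> converges to some \<open>l\<close>. Finally \<open>t x' + (\<alpha> - 1) (x - z) = u - t \<beta> g\<close> is a
  relaxation equation driven by a convergent term and an error \<open>t \<beta> g\<close> with \<open>g\<close> integrable, which
  forces \<open>x\<close> to converge to \<open>z + l / (\<alpha> - 1)\<close>.\<close>

section \<open>Riesz representation, gradient and Hessian\<close>

text \<open>The representative minimises \<open>|y|\<^sup>2 / 2 - f y\<close>; minimising sequences are Cauchy by the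
  parallelogram law.\<close>

lemma riesz_representation:
  fixes f :: "'a::{real_inner, complete_space} \<Rightarrow> real"
  assumes "bounded_linear f"
  shows "\<exists>g. \<forall>h. f h = inner g h"
proof -
  interpret bounded_linear f by fact
  define J where "J y = (norm y)\<^sup>2 / 2 - f y" for y
  obtain K where K: "\<And>y. norm (f y) \<le> norm y * K"
    using bounded by blast
  \<comment> \<open>Completing the square makes \<open>J\<close> bounded below, so its infimum
    \<open>m\<close> is a genuine lower bound.\<close>
  have J_ge: "J y \<ge> - K\<^sup>2 / 2" for y
  proof -
    have "f y \<le> norm y * K" using K[of y] by simp
    moreover have "0 \<le> (norm y - K)\<^sup>2" by simp
    ultimately show ?thesis by (simp add: J_def power2_diff)
  qed
  define m where "m = Inf (range J)"
  have bdd: "bdd_below (range J)" using J_ge by (auto intro!: bdd_belowI)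
  have m_le: "m \<le> J y" for y
    unfolding m_def using bdd by (auto intro: cInf_lower)
  have "\<exists>y. J y < m + 1 / real (Suc n)" for n
  proof -
    have "Inf (range J) < m + 1 / real (Suc n)" unfolding m_def by simp
    then show ?thesis using bdd by (subst (asm) cInf_less_iff) auto
  qed
  then obtain Y where Y: "\<And>n. J (Y n) < m + 1 / real (Suc n)" by metis
  \<comment> \<open>The parallelogram law; the linear part \<open>f\<close> cancels. Since
    \<open>J\<close> at the midpoint is at least \<open>m\<close>, near-minimisers are close to each
    other.\<close>
  have par: "J a + J b - 2 * J ((1/2) *\<^sub>R (a + b)) = (norm (a - b))\<^sup>2 / 4" for a b
    by (simp add: J_def power2_norm_eq_inner inner_diff inner_add inner_commute scaleR add
        field_simps)
  have close: "(norm (a - b))\<^sup>2 \<le> 4 * ((J a - m) + (J b - m))" for a b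
    using par[of a b] m_le[of "(1/2) *\<^sub>R (a + b)"] by argo
  have "Cauchy Y"
  proof (rule CauchyI)
    fix e :: real assume "0 < e"
    \<comment> \<open>The 8 is the factor 4 in \<open>close\<close> times two excesses, each at most
      \<open>1 / real N\<close>.\<close>
    then obtain N where N: "8 / e\<^sup>2 < real N" using reals_Archimedean2 by blast
    show "\<exists>M. \<forall>m\<ge>M. \<forall>n\<ge>M. norm (Y m - Y n) < e"
    proof (intro exI allI impI)
      fix i j assume ij: "N \<le> i" "N \<le> j"
      have N0: "0 < real N" using N \<open>0 < e\<close>
        by (meson less_trans zero_less_divide_iff zero_less_numeral zero_less_power)
      have *: "1 / real (Suc k) \<le> 1 / real N" if "N \<le> k" for k
        using that N0 by (intro divide_left_mono) auto
      have "(norm (Y i - Y j))\<^sup>2 \<le> 8 * (1 / real N)"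
        using close[of "Y i" "Y j"] Y[of i] Y[of j] *[OF ij(1)] *[OF ij(2)] by argo
      also have "\<dots> < e\<^sup>2" using N N0 \<open>0 < e\<close> by (simp add: field_simps)
      finally show "norm (Y i - Y j) < e" using \<open>0 < e\<close> by (auto intro: power2_less_imp_less)
    qed
  qed
  then obtain g where g: "Y \<longlonglongrightarrow> g" using Cauchy_convergent convergent_def by blast
  have "(\<lambda>n. J (Y n)) \<longlonglongrightarrow> J g"
    unfolding J_def by (intro tendsto_intros tendsto g) simp
  moreover have "(\<lambda>n. m + 1 / real (Suc n)) \<longlonglongrightarrow> m + 0"
    by (intro tendsto_intros LIMSEQ_Suc lim_inverse_n'[unfolded inverse_eq_divide])
  ultimately have "J g \<le> m + 0"
    by (rule LIMSEQ_le) (use Y less_imp_le in blast)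
  then have Jg: "J g \<le> J y" for y using m_le[of y] by simp
  have "f h = inner g h" for h
  proof -
    \<comment> \<open>First variation: along each line through the minimiser \<open>g\<close>,
      \<open>q\<close> is a quadratic polynomial whose slope at 0 must vanish.\<close>
    define q where "q s = J (g + s *\<^sub>R h)" for s
    have q: "q s = J g + s * (inner g h - f h) + s\<^sup>2 * (norm h)\<^sup>2 / 2" for s
      unfolding q_def J_def power2_norm_eq_inner
      by (simp add: inner_add inner_commute scaleR add power2_eq_square field_simps)
    have "DERIV q 0 :> inner g h - f h"
      unfolding q[abs_def] by (auto intro!: derivative_eq_intros)
    moreover have "q 0 \<le> q s" for s using Jg by (simp add: q_def)
    ultimately have "inner g h - f h = 0"
      using DERIV_local_min[of q "inner g h - f h" 0 1] by simp
    then show ?thesis by simp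
  qed
  then show ?thesis by blast
qed

text \<open>The definite description in \<open>gradient\<close> is legitimate: Riesz gives
  existence, and uniqueness of the Frechet derivative gives uniqueness.\<close>

lemma GDERIV_gradient:
  fixes f :: "'a::{real_inner, complete_space} \<Rightarrow> real"
  assumes "f differentiable (at x)"
  shows "GDERIV f x :> gradient f x"
proof -
  obtain D where D: "(f has_derivative D) (at x)" using assms differentiable_def by blast
  obtain g where "\<And>h. D h = inner g h"
    using riesz_representation[OF has_derivative_bounded_linear[OF D]] by blast
  then have "D = (\<lambda>h. inner h g)" by (intro ext) (simp add: inner_commute)
  then have g: "GDERIV f x :> g" using D by (simp add: gderiv_def)
  show ?thesis unfolding gradient_def
  proof (rule theI[of _ g])
    fix k assume "GDERIV f x :> k"
    then have "(\<lambda>h. inner h k) = (\<lambda>h. inner h g)"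
      using g unfolding gderiv_def by (rule has_derivative_unique)
    then have "inner (k - g) (k - g) = 0" by (metis inner_diff_right right_minus_eq)
    then show "k = g" by simp
  qed (rule g)
qed

text \<open>The gradient map is the first derivative \<open>D1\<close> followed by the Riesz map
  \<open>R\<close>. As \<open>R\<close> is bounded and linear, the chain rule makes the gradient
  differentiable, and \<open>hessian\<close> picks its derivative.\<close>

lemma gradient_has_derivative_hessian:
  fixes f :: "'a::{real_inner, complete_space} \<Rightarrow> real"
  assumes "twice_cont_diff f"
  shows "(gradient f has_derivative hessian f x) (at x)"
proof -
  obtain D1 :: "'a \<Rightarrow> 'a \<Rightarrow>\<^sub>L real" and D2 :: "'a \<Rightarrow> 'a \<Rightarrow>\<^sub>L 'a \<Rightarrow>\<^sub>L real"
    where D1: "\<And>x. (f has_derivative blinfun_apply (D1 x)) (at x)"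
      and D2: "\<And>x. (D1 has_derivative blinfun_apply (D2 x)) (at x)"
    using assms unfolding twice_cont_diff_def by blast
  obtain R :: "('a \<Rightarrow>\<^sub>L real) \<Rightarrow> 'a" where R: "\<And>L h. blinfun_apply L h = inner (R L) h"
    using riesz_representation[OF blinfun.bounded_linear_right] by metis
  have eqI: "a = b" if "\<And>h. inner a h = inner b h" for a b :: 'a
    using that by (metis inner_commute vector_eq_ldot)
  have "bounded_linear R"
  proof (rule bounded_linear_intro[where K = 1])
    show "R (a + b) = R a + R b" for a b
      by (rule eqI) (simp add: inner_add_left flip: R add: blinfun.add_left)
    show "R (c *\<^sub>R a) = c *\<^sub>R R a" for c a
      by (rule eqI) (simp flip: R add: blinfun.scaleR_left)
    \<comment> \<open>Evaluate \<open>L\<close> at its own representative and cancel one factor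
      \<open>norm (R L)\<close>.\<close>
    show "norm (R L) \<le> norm L * 1" for L
    proof (cases "R L = 0")
      case False
      have "norm (R L) * norm (R L) = L (R L)"
        by (simp add: R power2_norm_eq_inner flip: power2_eq_square)
      also have "\<dots> \<le> norm L * norm (R L)" using norm_blinfun[of L "R L"] by simp
      finally show ?thesis using False by simp
    qed simp
  qed
  moreover have "gradient f = (\<lambda>x. R (D1 x))"
  proof
    fix y
    have "GDERIV f y :> gradient f y"
      by (rule GDERIV_gradient) (use D1 differentiable_def in blast)
    then have "(\<lambda>h. inner h (gradient f y)) = blinfun_apply (D1 y)"
      unfolding gderiv_def using D1 by (rule has_derivative_unique)
    then show "gradient f y = R (D1 y)"
      by (intro eqI) (metis R inner_commute)
  qed
  ultimately have "(gradient f has_derivative (\<lambda>h. R (D2 x h))) (at x)"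
    using bounded_linear.has_derivative[OF _ D2] by metis
  then show ?thesis unfolding hessian_def
    using frechet_derivative_works differentiable_def by blast
qed

section \<open>Convexity and the ball of minimisers\<close>

text \<open>Restriction to the line through \<open>x\<close> and \<open>y\<close> reduces this to
  the tangent inequality for a convex function of one real variable.\<close>

lemma convex_gradient_inequality:
  fixes f :: "'a::real_inner \<Rightarrow> real"
  assumes "convex_on UNIV f" "GDERIV f x :> g"
  shows "f x + inner g (y - x) \<le> f y"
proof -
  define p where "p s = f (x + s *\<^sub>R (y - x))" for s :: real
  have "convex_on UNIV p"
  proof (rule convex_onI)
    fix t a b :: real assume "0 < t" "t < 1"
    moreover have "x + ((1 - t) *\<^sub>R a + t *\<^sub>R b) *\<^sub>R (y - x)
        = (1 - t) *\<^sub>R (x + a *\<^sub>R (y - x)) + t *\<^sub>R (x + b *\<^sub>R (y - x))"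
      by (simp add: algebra_simps)
    ultimately show "p ((1 - t) *\<^sub>R a + t *\<^sub>R b) \<le> (1 - t) * p a + t * p b"
      unfolding p_def using convex_onD[OF assms(1)] by (metis UNIV_I less_imp_le)
  qed simp
  moreover have "(p has_derivative (\<lambda>s. inner (s *\<^sub>R (y - x)) g)) (at 0)"
    unfolding p_def
    by (rule has_derivative_compose[of "\<lambda>s. x + s *\<^sub>R (y - x)" _ _ _ f "\<lambda>h. inner h g"])
      (use assms(2) in \<open>auto simp: gderiv_def intro!: derivative_eq_intros\<close>)
  then have "DERIV p 0 :> inner (y - x) g"
    by (simp add: has_field_derivative_def mult.commute[of _ "inner (y - x) g"])
  ultimately have "p 1 - p 0 \<ge> inner (y - x) g * (1 - 0)"
    using convex_on_imp_above_tangent[of UNIV p 0 1 "inner (y - x) g"] by simp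
  then show ?thesis by (simp add: p_def inner_commute)
qed

text \<open>The gradient inequality is tested at the point of the ball farthest in the direction of
  \<open>g\<close>. That point is a minimiser, so \<open>f\<close> there does not exceed
  \<open>f x\<close>. This is where the nonempty interior of the argmin set enters.\<close>

lemma inner_gradient_ge_of_argmin_ball:
  fixes f :: "'a::real_inner \<Rightarrow> real"
  assumes "convex_on UNIV f" "GDERIV f x :> g" "0 < r" "cball z r \<subseteq> argmin_set f"
  shows "r * norm g \<le> inner g (x - z)"
proof (cases "g = 0")
  case False
  define y where "y = z + (r / norm g) *\<^sub>R g"
  have "y \<in> cball z r" using False assms(3) by (simp add: y_def dist_norm)
  then have "f y \<le> f x" using assms(4) by (auto simp: argmin_set_def)
  then have "inner g (y - x) \<le> 0"
    using convex_gradient_inequality[OF assms(1,2), of y] by simp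
  moreover have "inner g (y - x) = r * norm g - inner g (x - z)"
    using False
    by (simp add: y_def inner_diff inner_add power2_norm_eq_inner[symmetric] power2_eq_square)
  ultimately show ?thesis by simp
qed simp

section \<open>Limits and integrals controlled by a dissipated energy\<close>

text \<open>The limit is the infimum of \<open>E\<close> over \<open>{T..}\<close>. The bound
  \<open>e \<le> E t\<close> is exported because the relaxation argument needs the sign of
  \<open>E t - e\<close>.\<close>

lemma nonincreasing_energy_converges:
  fixes E :: "real \<Rightarrow> real"
  assumes "\<And>t. T \<le> t \<Longrightarrow> DERIV E t :> E' t" "\<And>t. T \<le> t \<Longrightarrow> E' t \<le> 0" "\<And>t. T \<le> t \<Longrightarrow> 0 \<le> E t"
  obtains e where "(E \<longlongrightarrow> e) at_top" "\<And>t. T \<le> t \<Longrightarrow> e \<le> E t"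
proof -
  define e where "e = Inf (E ` {T..})"
  have bdd: "bdd_below (E ` {T..})" using assms(3) by (auto intro!: bdd_belowI)
  have le: "e \<le> E t" if "T \<le> t" for t
    unfolding e_def using bdd that by (auto intro: cInf_lower)
  have mono: "E t \<le> E s" if "T \<le> s" "s \<le> t" for s t
    using that assms(1,2) by (meson DERIV_nonpos_imp_nonincreasing order_trans)
  have "(E \<longlongrightarrow> e) at_top"
  proof (rule decreasing_tendsto)
    show "\<forall>\<^sub>F t in at_top. e \<le> E t" using eventually_ge_at_top[of T] by eventually_elim (rule le)
    fix b assume "e < b"
    then obtain s where "T \<le> s" "E s < b"
      unfolding e_def using bdd by (subst (asm) cInf_less_iff) auto
    moreover from this have "E t < b" if "s \<le> t" for t using mono[OF _ that] by fastforce
    ultimately show "\<forall>\<^sub>F t in at_top. E t < b"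
      unfolding eventually_at_top_linorder by blast
  qed
  with le show thesis using that by blast
qed

text \<open>Comparing with \<open>E\<close> replaces vector-valued integrals, which would need the sort \<open>banach\<close>;
  the sort \<open>{real_inner, complete_space}\<close> is not an instance of it.\<close>

lemma converges_if_derivative_dissipated:
  fixes f :: "real \<Rightarrow> 'a::{real_normed_vector, complete_space}"
  assumes f: "\<And>t. T \<le> t \<Longrightarrow> (f has_vector_derivative f' t) (at t)"
    and E: "\<And>t. T \<le> t \<Longrightarrow> DERIV E t :> E' t"
    and bound: "\<And>t. T \<le> t \<Longrightarrow> norm (f' t) \<le> - E' t"
    and nonneg: "\<And>t. T \<le> t \<Longrightarrow> 0 \<le> E t"
  shows "\<exists>l. (f \<longlongrightarrow> l) at_top"
proof -
  have "E' t \<le> 0" if "T \<le> t" for t using bound[OF that] norm_ge_zero[of "f' t"] by linarith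
  then obtain e where e: "(E \<longlongrightarrow> e) at_top"
    using nonincreasing_energy_converges[of T E E'] E nonneg by metis
  \<comment> \<open>Mean value inequality with \<open>- E\<close> as the comparison
    function.\<close>
  have diff: "norm (f t - f s) \<le> E s - E t" if "T \<le> s" "s \<le> t" for s t
  proof (cases "s = t")
    case False
    have "norm (f t - f s) \<le> (- E t) - (- E s)"
    proof (rule differentiable_bound_general[of s t f _ f' "\<lambda>t. - E' t"])
      show "continuous_on {s..t} f"
        using that has_vector_derivative_continuous[OF f]
        by (intro continuous_at_imp_continuous_on) auto
      show "continuous_on {s..t} (\<lambda>t. - E t)"
        using that DERIV_isCont[OF E]
        by (intro continuous_at_imp_continuous_on) (auto intro: continuous_minus)
      show "((\<lambda>t. - E t) has_vector_derivative - E' \<tau>) (at \<tau>)" if "s < \<tau>" for \<tau>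
        using E[of \<tau>] that \<open>T \<le> s\<close>
        by (auto intro!: has_vector_derivative_minus
            simp: has_real_derivative_iff_has_vector_derivative)
    qed (use that False f bound in auto)
    then show ?thesis by simp
  qed simp
  \<comment> \<open>Completeness yields a limit along the sequence \<open>N\<close>; letting the
    index tend to infinity in \<open>diff\<close> then carries it over to all real
    \<open>t\<close>.\<close>
  define N where "N = (\<lambda>n. T + real n)"
  have N: "filterlim N at_top sequentially"
    unfolding N_def by (intro filterlim_tendsto_add_at_top[OF tendsto_const] filterlim_real_sequentially)
  have lim_EN: "(\<lambda>n. E (N n)) \<longlonglongrightarrow> e" using filterlim_compose[OF e N] .
  have NT: "T \<le> N n" for n by (simp add: N_def)
  have diff': "norm (f (N i) - f (N j)) \<le> \<bar>E (N i) - E (N j)\<bar>" for i j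
    using diff[of "N i" "N j"] diff[of "N j" "N i"] NT[of i] NT[of j] norm_minus_commute[of "f (N i)" "f (N j)"]
    by (smt (verit))
  have "Cauchy (\<lambda>n. f (N n))"
  proof (rule CauchyI)
    fix \<epsilon> :: real assume "0 < \<epsilon>"
    then obtain M where "\<forall>i\<ge>M. \<forall>j\<ge>M. norm (E (N i) - E (N j)) < \<epsilon>"
      using CauchyD[OF LIMSEQ_imp_Cauchy[OF lim_EN]] by blast
    then show "\<exists>M. \<forall>i\<ge>M. \<forall>j\<ge>M. norm (f (N i) - f (N j)) < \<epsilon>"
      using diff' by (metis le_less_trans real_norm_def)
  qed
  then obtain l where l: "(\<lambda>n. f (N n)) \<longlonglongrightarrow> l" using Cauchy_convergent convergent_def by blast
  have "norm (f t - l) \<le> E t - e" if "T \<le> t" for t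
  proof -
    have "(\<lambda>n. norm (f (N n) - f t)) \<longlonglongrightarrow> norm (l - f t)" by (intro tendsto_intros l)
    moreover have "(\<lambda>n. E t - E (N n)) \<longlonglongrightarrow> E t - e" by (intro tendsto_intros lim_EN)
    moreover have "\<forall>\<^sub>F n in sequentially. norm (f (N n) - f t) \<le> E t - E (N n)"
      using N[unfolded filterlim_at_top, rule_format, of t]
      by eventually_elim (rule diff[OF that])
    ultimately have "norm (l - f t) \<le> E t - e"
      using tendsto_le[OF sequentially_bot] by blast
    then show ?thesis by (simp add: norm_minus_commute)
  qed
  then have "\<forall>\<^sub>F t in at_top. norm (f t - l) \<le> E t - e"
    unfolding eventually_at_top_linorder by blast
  moreover have "((\<lambda>t. E t - e) \<longlongrightarrow> 0) at_top" using e by (simp add: LIM_zero_iff)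
  ultimately have "((\<lambda>t. f t - l) \<longlongrightarrow> 0) at_top" by (rule Lim_null_comparison)
  then show ?thesis using LIM_zero_iff by blast
qed

text \<open>A primitive of \<open>h\<close> has its derivative dominated by \<open>- E'\<close>
  beyond \<open>T\<close>, hence converges. The fundamental theorem for nonnegative integrands turns
  this limit into the value of the integral.\<close>

lemma nn_integral_finite_if_dissipated:
  fixes h :: "real \<Rightarrow> real"
  assumes h: "continuous_on {a..} h" "\<And>t. a \<le> t \<Longrightarrow> 0 \<le> h t"
    and "a \<le> T"
    and E: "\<And>t. T \<le> t \<Longrightarrow> DERIV E t :> E' t"
    and bound: "\<And>t. T \<le> t \<Longrightarrow> h t \<le> - E' t"
    and nonneg: "\<And>t. T \<le> t \<Longrightarrow> 0 \<le> E t"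
  shows "(\<integral>\<^sup>+ t\<in>{a..}. ennreal (h t) \<partial>lborel) < \<infinity>"
proof -
  \<comment> \<open>Extending \<open>h\<close> by the constant \<open>h a\<close> to the left, and
    integrating from \<open>a - 1\<close>, makes \<open>F\<close> two-sidedly differentiable even at
    \<open>a\<close>.\<close>
  define H where "H t = h (max t a)" for t
  have H: "continuous_on A H" for A
    unfolding H_def by (rule continuous_on_compose2[OF h(1)]) (auto intro!: continuous_intros)
  define F where "F t = integral {a - 1..t} H" for t
  have F: "DERIV F t :> H t" if "a \<le> t" for t
  proof -
    have "(F has_vector_derivative H t) (at t within {a - 1..t + 1})"
      unfolding F_def using that by (intro integral_has_vector_derivative H) auto
    moreover have "at t within {a - 1..t + 1} = at t"
      using that by (intro at_within_interior) (simp add: interior_atLeastAtMost_real)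
    ultimately show ?thesis by (simp add: has_real_derivative_iff_has_vector_derivative)
  qed
  have "\<exists>l. (F \<longlongrightarrow> l) at_top"
  proof (rule converges_if_derivative_dissipated[of T F H E E'])
    fix t assume t: "T \<le> t"
    then show "(F has_vector_derivative H t) (at t)"
      using F \<open>a \<le> T\<close> by (simp add: has_real_derivative_iff_has_vector_derivative)
    show "norm (H t) \<le> - E' t" using t \<open>a \<le> T\<close> h(2) bound by (simp add: H_def max_absorb1)
  qed (use E nonneg in auto)
  then obtain l where l: "(F \<longlongrightarrow> l) at_top" by blast
  have "(\<integral>\<^sup>+ t. ennreal (H t) * indicator {a..} t \<partial>lborel) = l - F a"
    using h(2) by (intro nn_integral_FTC_atLeast F l borel_measurable_continuous_onI H) (auto simp: H_def)
  also have "(\<integral>\<^sup>+ t. ennreal (H t) * indicator {a..} t \<partial>lborel)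
      = (\<integral>\<^sup>+ t\<in>{a..}. ennreal (h t) \<partial>lborel)"
    by (intro nn_integral_cong) (auto simp: H_def indicator_def max_absorb1)
  finally show ?thesis by simp
qed

text \<open>The integrating factor \<open>t powr \<kappa>\<close> turns the hypothesis into a bound on the derivative of
  \<open>t powr \<kappa> *\<^sub>R y t\<close>, which is compared with \<open>\<phi>\<close>. The term \<open>- (E - e)\<close> in \<open>\<phi>\<close> pays for the
  dissipated part of the forcing.\<close>

lemma tendsto_zero_if_relaxation_dissipated:
  fixes y :: "real \<Rightarrow> 'a::real_normed_vector"
  assumes "0 < T" "0 < \<kappa>"
    and y: "\<And>t. T \<le> t \<Longrightarrow> (y has_vector_derivative y' t) (at t)"
    and E: "\<And>t. T \<le> t \<Longrightarrow> DERIV E t :> E' t"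
    and nonneg: "\<And>t. T \<le> t \<Longrightarrow> 0 \<le> E t"
    and dissip: "\<And>t. T \<le> t \<Longrightarrow> E' t \<le> 0"
    and bound: "\<And>t. T \<le> t \<Longrightarrow> norm (t *\<^sub>R y' t + \<kappa> *\<^sub>R y t) \<le> a t - t * E' t"
    and a: "(a \<longlongrightarrow> 0) at_top"
  shows "(y \<longlongrightarrow> 0) at_top"
proof (rule tendstoI)
  fix \<delta> :: real assume "0 < \<delta>"
  \<comment> \<open>Two thirds of \<delta> go to the bound \<open>2 * \<epsilon>\<close> built into
    \<open>\<phi>\<close>, one third to the decaying initial term
    \<open>C * t powr (- \<kappa>)\<close>.\<close>
  define \<epsilon> where "\<epsilon> = \<delta> / 3"
  have "0 < \<epsilon>" using \<open>0 < \<delta>\<close> by (simp add: \<epsilon>_def)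
  obtain e where e: "(E \<longlongrightarrow> e) at_top" "\<And>t. T \<le> t \<Longrightarrow> e \<le> E t"
    using nonincreasing_energy_converges[of T E E'] E dissip nonneg by metis
  have "\<forall>\<^sub>F t in at_top. a t < \<epsilon> * \<kappa>"
    using order_tendstoD(2)[OF a] \<open>0 < \<epsilon>\<close> \<open>0 < \<kappa>\<close> by simp
  moreover have "\<forall>\<^sub>F t in at_top. E t < e + \<epsilon>"
    using order_tendstoD(2)[OF e(1)] \<open>0 < \<epsilon>\<close> by simp
  ultimately have "\<forall>\<^sub>F t in at_top. T \<le> t \<and> a t < \<epsilon> * \<kappa> \<and> E t < e + \<epsilon>"
    using eventually_ge_at_top[of T] by eventually_elim simp
  then obtain S where S: "\<And>t. S \<le> t \<Longrightarrow> T \<le> t \<and> a t < \<epsilon> * \<kappa> \<and> E t < e + \<epsilon>"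
    unfolding eventually_at_top_linorder by blast
  have "0 < S" using S[of S] \<open>0 < T\<close> by simp
  define Y where "Y t = (t powr \<kappa>) *\<^sub>R y t" for t
  define Y' where "Y' t = (t powr (\<kappa> - 1)) *\<^sub>R (t *\<^sub>R y' t + \<kappa> *\<^sub>R y t)" for t
  define \<phi> where "\<phi> t = t powr \<kappa> * (2 * \<epsilon> - (E t - e))" for t
  define \<phi>' where "\<phi>' t = t powr (\<kappa> - 1) * (\<kappa> * (2 * \<epsilon> - (E t - e)) - t * E' t)" for t
  have powr_split: "t powr \<kappa> = t powr (\<kappa> - 1) * t" if "0 < t" for t
    using that by (simp add: powr_diff)
  have dpowr: "DERIV (\<lambda>t. t powr \<kappa>) t :> \<kappa> * t powr (\<kappa> - 1)" if "0 < t" for t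
    using that by (rule has_real_derivative_powr)
  have Y: "(Y has_vector_derivative Y' t) (at t)" if "S \<le> t" for t
  proof -
    have "0 < t" "T \<le> t" using that \<open>0 < S\<close> S by auto
    have "(Y has_vector_derivative (t powr \<kappa>) *\<^sub>R y' t + (\<kappa> * t powr (\<kappa> - 1)) *\<^sub>R y t) (at t)"
      unfolding Y_def using dpowr[OF \<open>0 < t\<close>] y[OF \<open>T \<le> t\<close>] by (rule has_vector_derivative_scaleR)
    then show ?thesis
      using powr_split[OF \<open>0 < t\<close>] by (simp add: Y'_def scaleR_add_right mult.commute)
  qed
  have \<phi>: "DERIV \<phi> t :> \<phi>' t" if "S \<le> t" for t
  proof -
    have "0 < t" "T \<le> t" using that \<open>0 < S\<close> S by auto
    have "DERIV (\<lambda>t. 2 * \<epsilon> - (E t - e)) t :> - E' t"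
      using E[OF \<open>T \<le> t\<close>] by (auto intro!: derivative_eq_intros)
    from DERIV_mult[OF dpowr[OF \<open>0 < t\<close>] this] show ?thesis
      using powr_split[OF \<open>0 < t\<close>] unfolding \<phi>_def[abs_def] \<phi>'_def
      by (simp add: algebra_simps)
  qed
  have bnd: "norm (Y' t) \<le> \<phi>' t" if "S \<le> t" for t
  proof -
    \<comment> \<open>Of the amount \<open>2 * \<epsilon>\<close>, one \<epsilon> covers
      \<open>E t - e\<close>, and the other, multiplied by \<kappa>, dominates
      \<open>a t\<close>.\<close>
    have "a t \<le> \<kappa> * (2 * \<epsilon> - (E t - e))"
    proof -
      have "a t \<le> \<kappa> * \<epsilon>" using S[OF that] by (simp add: mult.commute)
      also have "\<dots> \<le> \<kappa> * (2 * \<epsilon> - (E t - e))"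
        using S[OF that] \<open>0 < \<kappa>\<close> by (intro mult_left_mono) auto
      finally show ?thesis .
    qed
    then have "norm (t *\<^sub>R y' t + \<kappa> *\<^sub>R y t) \<le> \<kappa> * (2 * \<epsilon> - (E t - e)) - t * E' t"
      using bound[of t] S[OF that] by linarith
    then show ?thesis unfolding Y'_def \<phi>'_def by (simp add: mult_left_mono)
  qed
  define C where "C = norm (Y S) + \<bar>\<phi> S\<bar>"
  have main: "norm (y t) \<le> C * t powr (- \<kappa>) + 2 * \<epsilon>" if "S < t" for t
  proof -
    have "0 < t" using that \<open>0 < S\<close> by simp
    have "norm (Y t - Y S) \<le> \<phi> t - \<phi> S"
    proof (rule differentiable_bound_general[of S t Y \<phi> Y' \<phi>'])
      show "continuous_on {S..t} Y"
        using has_vector_derivative_continuous[OF Y]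
        by (intro continuous_at_imp_continuous_on) auto
      show "continuous_on {S..t} \<phi>"
        using DERIV_isCont[OF \<phi>] by (intro continuous_at_imp_continuous_on) auto
    qed (use that Y \<phi> bnd in \<open>auto simp: has_real_derivative_iff_has_vector_derivative\<close>)
    then have "norm (Y t) \<le> C + \<phi> t"
      using norm_triangle_ineq2[of "Y t" "Y S"] unfolding C_def by linarith
    also have "\<phi> t \<le> t powr \<kappa> * (2 * \<epsilon>)"
      unfolding \<phi>_def using S[of t] that e(2)[of t] by (intro mult_left_mono) auto
    finally have "t powr \<kappa> * norm (y t) \<le> C + t powr \<kappa> * (2 * \<epsilon>)" by (simp add: Y_def)
    then show ?thesis using \<open>0 < t\<close> by (simp add: powr_minus field_simps)
  qed
  have "((\<lambda>t. C * t powr (- \<kappa>)) \<longlongrightarrow> C * 0) at_top"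
    using \<open>0 < \<kappa>\<close> by (intro tendsto_mult_left tendsto_neg_powr filterlim_ident) auto
  then have "\<forall>\<^sub>F t in at_top. C * t powr (- \<kappa>) < \<epsilon>"
    using order_tendstoD(2) \<open>0 < \<epsilon>\<close> by fastforce
  then show "\<forall>\<^sub>F t in at_top. dist (y t) 0 < \<delta>"
    using eventually_gt_at_top[of S]
  proof eventually_elim
    case (elim t)
    then show ?case using main[of t] by (simp add: \<epsilon>_def)
  qed
qed

section \<open>The trajectory: Lyapunov energy and its derivative\<close>

theorem theorem2p2:
  fixes \<Phi> :: "'a::{real_inner, complete_space} \<Rightarrow> real"
    and x :: "real \<Rightarrow> 'a"
    and \<alpha> \<beta> t0 :: real
  assumes "\<alpha> > 3" and "\<beta> > 0" and "t0 > 0"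
    and "twice_cont_diff \<Phi>"
    and "convex_on UNIV \<Phi>"
    and "interior (argmin_set \<Phi>) \<noteq> {}"
    and "classical_global_solution \<alpha> \<beta> t0 \<Phi> x"
  shows "(\<exists>xstar \<in> argmin_set \<Phi>. (x \<longlongrightarrow> xstar) at_top) \<and>
         (\<integral>\<^sup>+ t\<in>{t0..}. ennreal (t * norm (gradient \<Phi> (x t))) \<partial>lborel) < \<infinity>"
proof -
  obtain x' x'' where
    x: "\<And>t. t0 \<le> t \<Longrightarrow> (x has_vector_derivative x' t) (at t within {t0..})" and
    x': "\<And>t. t0 \<le> t \<Longrightarrow> (x' has_vector_derivative x'' t) (at t within {t0..})" and
    ode: "\<And>t. t0 \<le> t \<Longrightarrow> x'' t + (\<alpha> / t) *\<^sub>R x' t + \<beta> *\<^sub>R hessian \<Phi> (x t) (x' t)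
                   + gradient \<Phi> (x t) = 0"
    using assms(7) unfolding classical_global_solution_def by blast
  obtain z r where r: "0 < r" "cball z r \<subseteq> argmin_set \<Phi>"
    using assms(6) mem_interior_cball by blast
  have z: "\<Phi> z \<le> \<Phi> y" for y
    using r(1) subsetD[OF r(2), of z] by (simp add: argmin_set_def)
  have grad: "GDERIV \<Phi> y :> gradient \<Phi> y" for y
    using assms(4) by (intro GDERIV_gradient) (auto simp: twice_cont_diff_def differentiable_def)

  define g where "g t = gradient \<Phi> (x t)" for t
  define h where "h t = hessian \<Phi> (x t) (x' t)" for t
  define W where "W t = \<Phi> (x t) - \<Phi> z" for t
  define u where "u t = (\<alpha> - 1) *\<^sub>R (x t - z) + t *\<^sub>R (x' t + \<beta> *\<^sub>R g t)" for t
  define E where "E t = t * (t - \<beta>) * W t + inner (u t) (u t) / 2" for t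
  \<comment> \<open>The derivative of \<open>E\<close> after substituting that of \<open>u\<close>.
    The weight \<open>t * (t - \<beta>)\<close> on \<open>W\<close> is chosen so that the terms in
    \<open>inner (g t) (x' t)\<close> cancel.\<close>
  define E' where "E' t = (2 * t - \<beta>) * W t - (t - \<beta>) * (\<alpha> - 1) * inner (g t) (x t - z)
      - \<beta> * t * (t - \<beta>) * inner (g t) (g t)" for t

  \<comment> \<open>Strictly after \<open>t0\<close> the one-sided derivatives of the solution are
    two-sided.\<close>
  have within: "at t within {t0..} = at t" if "t0 < t" for t
    using that by (intro at_within_interior) simp
  have dx: "(x has_vector_derivative x' t) (at t)" if "t0 < t" for t
    using x[of t] within[OF that] that by simp
  have dx': "(x' has_vector_derivative x'' t) (at t)" if "t0 < t" for t
    using x'[of t] within[OF that] that by simp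
  have dg: "(g has_vector_derivative h t) (at t)" if "t0 < t" for t
    using vector_derivative_diff_chain_within[OF dx[OF that], of "gradient \<Phi>" "hessian \<Phi> (x t)"]
      has_derivative_at_withinI[OF gradient_has_derivative_hessian[OF assms(4), of "x t"]]
    by (simp add: g_def[abs_def] h_def comp_def)
  have dW: "DERIV W t :> inner (g t) (x' t)" if "t0 < t" for t
    using vector_derivative_diff_chain_within[OF dx[OF that], of \<Phi> "\<lambda>k. inner k (g t)"]
      has_derivative_at_withinI[OF grad[unfolded gderiv_def, of "x t"]]
    unfolding W_def[abs_def]
    by (auto simp: g_def comp_def has_real_derivative_iff_has_vector_derivative inner_commute
        intro!: derivative_eq_intros)
  \<comment> \<open>The Hessian term is the derivative of \<open>\<beta> *\<^sub>R g t\<close>.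
    Multiplying the equation by \<open>t\<close> gives \<open>- \<alpha> *\<^sub>R x' t\<close>,
    which cancels the two contributions of \<open>x' t\<close> with coefficients \<alpha> - 1 and
    1.\<close>
  have du: "(u has_vector_derivative - (t - \<beta>) *\<^sub>R g t) (at t)" if "t0 < t" for t
  proof -
    have "x'' t + \<beta> *\<^sub>R h t
        = (x'' t + (\<alpha> / t) *\<^sub>R x' t + \<beta> *\<^sub>R h t + g t) - (\<alpha> / t) *\<^sub>R x' t - g t"
      by (simp add: algebra_simps)
    also have "\<dots> = - (\<alpha> / t) *\<^sub>R x' t - g t"
      using ode[of t] that by (simp add: g_def h_def)
    finally have "t *\<^sub>R (x'' t + \<beta> *\<^sub>R h t) = - \<alpha> *\<^sub>R x' t - t *\<^sub>R g t"
      using that assms(3) by (simp add: scaleR_diff_right)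
    then have "(\<alpha> - 1) *\<^sub>R x' t + (t *\<^sub>R (x'' t + \<beta> *\<^sub>R h t) + (x' t + \<beta> *\<^sub>R g t))
        = - (t - \<beta>) *\<^sub>R g t"
      by (simp add: algebra_simps)
    moreover have "(u has_vector_derivative
        (\<alpha> - 1) *\<^sub>R x' t + (t *\<^sub>R (x'' t + \<beta> *\<^sub>R h t) + (x' t + \<beta> *\<^sub>R g t))) (at t)"
      unfolding u_def[abs_def]
      by (auto intro!: derivative_eq_intros dx[OF that] dx'[OF that] dg[OF that])
    ultimately show ?thesis by simp
  qed
  have dE: "DERIV E t :> E' t" if "t0 < t" for t
  proof -
    have "((\<lambda>t. inner (u t) (u t)) has_vector_derivative
        inner (u t) (- (t - \<beta>) *\<^sub>R g t) + inner (- (t - \<beta>) *\<^sub>R g t) (u t)) (at t)"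
      by (rule bounded_bilinear.has_vector_derivative[OF bounded_bilinear_inner du du]) fact+
    then have "DERIV (\<lambda>t. inner (u t) (u t)) t :> - 2 * (t - \<beta>) * inner (g t) (u t)"
      by (simp add: has_real_derivative_iff_has_vector_derivative inner_commute algebra_simps)
    then have "DERIV E t :> (2 * t - \<beta>) * W t + t * (t - \<beta>) * inner (g t) (x' t)
        - (t - \<beta>) * inner (g t) (u t)"
      unfolding E_def[abs_def]
      by (auto intro!: derivative_eq_intros dW[OF that] simp: field_simps)
    moreover have "inner (g t) (u t) = (\<alpha> - 1) * inner (g t) (x t - z) + t * inner (g t) (x' t)
        + t * \<beta> * inner (g t) (g t)"
      by (simp add: u_def inner_add_right algebra_simps)
    ultimately show ?thesis
      unfolding E'_def by (simp add: algebra_simps)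
  qed

  \<comment> \<open>Dissipation of the energy for large times\<close>
  define \<delta> where "\<delta> = (\<alpha> - 3) / 2"
  \<comment> \<open>The entries ensure, in turn, two-sided derivatives, weights
    \<open>t - \<beta>\<close> of at least 1, and absorption of the \<open>W\<close> term in
    \<open>dissip\<close>.\<close>
  define T where "T = Max {t0 + 1, \<beta> + 1, \<beta> * (1 + \<delta>) / \<delta>}"
  define c where "c = \<delta> * r"
  have "0 < \<delta>" "0 < c" using assms(1) r(1) by (simp_all add: \<delta>_def c_def)
  have T: "t0 < t" "1 \<le> t - \<beta>" "\<beta> * (1 + \<delta>) \<le> \<delta> * t" "0 < t" if "T \<le> t" for t
  proof -
    have "t0 + 1 \<le> t" "\<beta> + 1 \<le> t" "\<beta> * (1 + \<delta>) / \<delta> \<le> t" using that by (auto simp: T_def)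
    then show "t0 < t" "1 \<le> t - \<beta>" "\<beta> * (1 + \<delta>) \<le> \<delta> * t" "0 < t"
      using \<open>0 < \<delta>\<close> assms(3) by (auto simp: field_simps)
  qed
  have W_nonneg: "0 \<le> W t" for t by (simp add: W_def z)
  have E_nonneg: "0 \<le> E t" if "T \<le> t" for t
    using T[OF that] W_nonneg[of t] by (simp add: E_def)
  \<comment> \<open>The weight \<open>\<alpha> - 1 = (2 + \<delta>) + \<delta>\<close> is split: the first part of the inner product absorbs the
    \<open>W\<close> term by convexity, the second controls the norm of the gradient through the ball.\<close>
  have dissip: "c * ((t - \<beta>) * norm (g t)) \<le> - E' t" if "T \<le> t" for t
  proof -
    note t = T[OF that]
    define P where "P = inner (g t) (x t - z)"
    have "W t \<le> P"
      using convex_gradient_inequality[OF assms(5) grad, of "x t" z]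
      by (simp add: W_def P_def g_def inner_diff_right)
    moreover have "r * norm (g t) \<le> P"
      using inner_gradient_ge_of_argmin_ball[OF assms(5) grad r] by (simp add: P_def g_def)
    ultimately have "(t - \<beta>) * ((2 + \<delta>) * W t + \<delta> * (r * norm (g t)))
        \<le> (t - \<beta>) * ((2 + \<delta>) * P + \<delta> * P)"
      using t \<open>0 < \<delta>\<close> by (intro mult_left_mono add_mono) auto
    also have "\<dots> = (t - \<beta>) * (\<alpha> - 1) * P"
      by (simp add: \<delta>_def field_simps)
    finally have "(t - \<beta>) * ((2 + \<delta>) * W t + \<delta> * (r * norm (g t))) \<le> (t - \<beta>) * (\<alpha> - 1) * P" .
    \<comment> \<open>The coefficient is
      \<open>(2 + \<delta>) * (t - \<beta>) - (2 * t - \<beta>)\<close>, the surplus left after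
      absorbing the \<open>W\<close> term of \<open>E'\<close>.\<close>
    moreover have "0 \<le> (\<delta> * t - \<beta> * (1 + \<delta>)) * W t" using t W_nonneg by simp
    moreover have "0 \<le> \<beta> * t * (t - \<beta>) * inner (g t) (g t)" using t assms(2) by simp
    ultimately show ?thesis
      unfolding E'_def P_def[symmetric] c_def by (simp add: algebra_simps)
  qed
  have E'_nonpos: "E' t \<le> 0" if "T \<le> t" for t
  proof -
    have "0 \<le> c * ((t - \<beta>) * norm (g t))" using T[OF that] \<open>0 < c\<close> by simp
    then show ?thesis using dissip[OF that] by simp
  qed
  \<comment> \<open>Each of the three comparison arguments below uses its own multiple of
    \<open>E\<close>.\<close>
  have scaled: "DERIV (\<lambda>t. k * E t) t :> k * E' t" if "T \<le> t" for k t
    using dE T(1)[OF that] by (auto intro!: derivative_eq_intros)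

  \<comment> \<open>Strong convergence of the trajectory\<close>
  have "\<exists>l. (u \<longlongrightarrow> l) at_top"
  proof (rule converges_if_derivative_dissipated)
    fix t assume t: "T \<le> t"
    show "(u has_vector_derivative - (t - \<beta>) *\<^sub>R g t) (at t)" using du T[OF t] by simp
    show "DERIV (\<lambda>t. (1 / c) * E t) t :> (1 / c) * E' t" using scaled[OF t] .
    have "norm (- (t - \<beta>) *\<^sub>R g t) = (t - \<beta>) * norm (g t)"
      using T[OF t] by (simp del: minus_diff_eq)
    also have "\<dots> \<le> - ((1 / c) * E' t)"
      using dissip[OF t] \<open>0 < c\<close> by (simp add: field_simps)
    finally show "norm (- (t - \<beta>) *\<^sub>R g t) \<le> - ((1 / c) * E' t)" .
    show "0 \<le> (1 / c) * E t" using E_nonneg[OF t] \<open>0 < c\<close> by simp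
  qed
  then obtain l where l: "(u \<longlongrightarrow> l) at_top" by blast
  \<comment> \<open>The equilibrium of the limiting relaxation equation:
    \<open>(\<alpha> - 1) *\<^sub>R (xs - z) = l\<close>.\<close>
  define xs where "xs = z + (1 / (\<alpha> - 1)) *\<^sub>R l"
  have "((\<lambda>t. x t - xs) \<longlongrightarrow> 0) at_top"
  proof (rule tendsto_zero_if_relaxation_dissipated)
    show "0 < T" using T by simp
    show "0 < \<alpha> - 1" using assms(1) by simp
    show "((\<lambda>t. norm (u t - l)) \<longlongrightarrow> 0) at_top"
      using l by (simp add: tendsto_norm_zero LIM_zero_iff)
    fix t assume t: "T \<le> t"
    show "((\<lambda>t. x t - xs) has_vector_derivative x' t) (at t)"
      using dx T[OF t] by (auto intro!: derivative_eq_intros)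
    show "DERIV (\<lambda>t. (\<beta> / c) * E t) t :> (\<beta> / c) * E' t" using scaled[OF t] .
    show "0 \<le> (\<beta> / c) * E t" using E_nonneg[OF t] \<open>0 < c\<close> assms(2) by simp
    show "(\<beta> / c) * E' t \<le> 0"
      using E'_nonpos[OF t] \<open>0 < c\<close> assms(2) by (intro mult_nonneg_nonpos) auto
    have "t *\<^sub>R x' t + (\<alpha> - 1) *\<^sub>R (x t - xs) = (u t - l) - (t * \<beta>) *\<^sub>R g t"
      using assms(1) by (simp add: u_def xs_def algebra_simps)
    then have "norm (t *\<^sub>R x' t + (\<alpha> - 1) *\<^sub>R (x t - xs)) \<le> norm (u t - l) + t * (\<beta> * norm (g t))"
      using norm_triangle_ineq4[of "u t - l" "(t * \<beta>) *\<^sub>R g t"] T[OF t] assms(2)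
      by (simp add: mult.assoc)
    \<comment> \<open>Since \<open>t - \<beta>\<close> is at least 1, the dissipation bound controls
      \<open>norm (g t)\<close> itself; the factor \<open>t\<close> is left for the relaxation
      lemma.\<close>
    moreover have "\<beta> * norm (g t) \<le> - ((\<beta> / c) * E' t)"
    proof -
      have "norm (g t) \<le> (t - \<beta>) * norm (g t)"
        using T[OF t] mult_right_mono[of 1 "t - \<beta>" "norm (g t)"] by simp
      also have "\<dots> \<le> - E' t / c"
        using dissip[OF t] \<open>0 < c\<close> by (simp add: field_simps)
      finally have "\<beta> * norm (g t) \<le> \<beta> * (- E' t / c)"
        using assms(2) by (intro mult_left_mono) auto
      then show ?thesis by simp
    qed
    then have "t * (\<beta> * norm (g t)) \<le> t * (- ((\<beta> / c) * E' t))"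
      using T[OF t] by (intro mult_left_mono) auto
    ultimately show "norm (t *\<^sub>R x' t + (\<alpha> - 1) *\<^sub>R (x t - xs))
        \<le> norm (u t - l) - t * ((\<beta> / c) * E' t)" by simp
  qed
  then have lim: "(x \<longlongrightarrow> xs) at_top" by (simp add: LIM_zero_iff)

  \<comment> \<open>Optimality of the limit and integrability of the gradient\<close>
  have "xs \<in> argmin_set \<Phi>"
  proof -
    \<comment> \<open>With \<open>t - \<beta>\<close> at least 1 and \<open>E\<close> nonincreasing,
      this crude rate already forces the limit of \<open>W\<close> to be at most 0.\<close>
    have "W t \<le> E T / t" if "T \<le> t" for t
    proof -
      have "t * W t \<le> t * (t - \<beta>) * W t"
        using T[OF that] W_nonneg[of t] by (intro mult_right_mono) auto
      also have "\<dots> \<le> E t" by (simp add: E_def)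
      also have "E t \<le> E T"
        using that T dE E'_nonpos by (meson DERIV_nonpos_imp_nonincreasing order_trans)
      finally show ?thesis using T[OF that] by (simp add: field_simps)
    qed
    then have "\<forall>\<^sub>F t in at_top. W t \<le> E T / t" unfolding eventually_at_top_linorder by blast
    moreover have "((\<lambda>t. E T / t) \<longlongrightarrow> 0) at_top"
      by (intro tendsto_divide_0[OF tendsto_const] filterlim_at_top_imp_at_infinity filterlim_ident)
    moreover have "isCont \<Phi> xs"
      using grad[of xs] unfolding gderiv_def by (rule has_derivative_continuous)
    then have "(W \<longlongrightarrow> \<Phi> xs - \<Phi> z) at_top"
      unfolding W_def by (intro tendsto_intros isCont_tendsto_compose[OF _ lim])
    ultimately have "\<Phi> xs - \<Phi> z \<le> 0"
      using tendsto_le[OF trivial_limit_at_top_linorder] by blast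
    then show ?thesis using z by (auto simp: argmin_set_def intro: order_trans)
  qed
  moreover have "(\<integral>\<^sup>+ t\<in>{t0..}. ennreal (t * norm (g t)) \<partial>lborel) < \<infinity>"
  proof (rule nn_integral_finite_if_dissipated)
    have cx: "continuous_on {t0..} x"
      using has_vector_derivative_continuous[OF x] by (simp add: continuous_on_eq_continuous_within)
    have "continuous_on UNIV (gradient \<Phi>)"
      using gradient_has_derivative_hessian[OF assms(4)] has_derivative_continuous
      by (blast intro: continuous_at_imp_continuous_on)
    from continuous_on_compose2[OF this cx] have "continuous_on {t0..} g"
      by (simp add: g_def[abs_def])
    then show "continuous_on {t0..} (\<lambda>t. t * norm (g t))"
      by (intro continuous_intros)
    show "0 \<le> t * norm (g t)" if "t0 \<le> t" for t using that assms(3) by simp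
    show "t0 \<le> T" using T(1)[of T] by simp
    fix t assume t: "T \<le> t"
    show "DERIV (\<lambda>t. ((1 + \<beta>) / c) * E t) t :> ((1 + \<beta>) / c) * E' t" using scaled[OF t] .
    show "0 \<le> ((1 + \<beta>) / c) * E t" using E_nonneg[OF t] \<open>0 < c\<close> assms(2) by simp
    \<comment> \<open>Write \<open>t\<close> as \<open>(t - \<beta>) + \<beta>\<close> and bound the
      second summand by \<open>\<beta> * (t - \<beta>)\<close>; this explains the factor
      \<open>1 + \<beta>\<close>.\<close>
    have "t \<le> (1 + \<beta>) * (t - \<beta>)"
      using T[OF t] mult_left_mono[of 1 "t - \<beta>" \<beta>] assms(2) by (simp add: algebra_simps)
    then have "t * norm (g t) \<le> (1 + \<beta>) * ((t - \<beta>) * norm (g t))"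
      unfolding mult.assoc[symmetric] by (rule mult_right_mono) simp
    also have "\<dots> \<le> (1 + \<beta>) * (- E' t / c)"
      using dissip[OF t] \<open>0 < c\<close> assms(2) by (intro mult_left_mono) (auto simp: field_simps)
    finally show "t * norm (g t) \<le> - (((1 + \<beta>) / c) * E' t)" by simp
  qed
  ultimately show ?thesis using lim unfolding g_def by blast
qed

end
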